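(* Let $\Gamma$ be a countable graph. Then (i) there exists an idempotent endomorphism $f$ of the countable universal graph $R$ such that $\operatorname{im} f\cong\Gamma$ if and only if $\Gamma$ is algebraically closed; (ii) if $\Gamma$ is algebraically closed, there are $2^{\aleph_0}$ idempotent endomorphisms $f$ of $R$ such that $\operatorname{im} f\cong\Gamma$.
   Context: A graph is a pair $(V,E)$ with $E$ an irreflexive symmetric binary relation on $V$. A graph is algebraically closed if for every finite set $A$ of vertices there is a vertex adjacent to every vertex of $A$. The countable universal graph $R$ is the Fraïssé limit of the finite graphs (the unique countable existentially closed graph). For an endomorphism $f$ of $R=(V,E)$, $\operatorname{im} f$ is the graph $(Vf,Ef)$. *)

theory Defs
  imports "HOL-Library.FuncSet" "HOL-Library.Countable_Set" "HOL-Library.Equipollence"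
begin

type_synonym 'a graph = "'a set \<times> ('a \<times> 'a) set"

abbreviation verts :: "'a graph \<Rightarrow> 'a set" where "verts \<equiv> fst"
abbreviation edges :: "'a graph \<Rightarrow> ('a \<times> 'a) set" where "edges \<equiv> snd"

definition is_graph :: "'a graph \<Rightarrow> bool" where
  "is_graph G \<longleftrightarrow> edges G \<subseteq> verts G \<times> verts G \<and> irrefl (edges G) \<and> sym (edges G)"

definition countable_graph :: "'a graph \<Rightarrow> bool" where
  "countable_graph G \<longleftrightarrow> is_graph G \<and> countable (verts G)"

definition finite_graph :: "'a graph \<Rightarrow> bool" where
  "finite_graph G \<longleftrightarrow> is_graph G \<and> finite (verts G)"

definition algebraically_closed :: "'a graph \<Rightarrow> bool" where
  "algebraically_closed G \<longleftrightarrow>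
     (\<forall>A. finite A \<and> A \<subseteq> verts G \<longrightarrow> (\<exists>v\<in>verts G. \<forall>a\<in>A. (v, a) \<in> edges G))"

definition induced_subgraph :: "'a graph \<Rightarrow> 'a set \<Rightarrow> 'a graph" where
  "induced_subgraph G A = (A, edges G \<inter> A \<times> A)"

definition graph_iso :: "('a \<Rightarrow> 'b) \<Rightarrow> 'a graph \<Rightarrow> 'b graph \<Rightarrow> bool" where
  "graph_iso h G H \<longleftrightarrow> bij_betw h (verts G) (verts H) \<and>
     (\<forall>x\<in>verts G. \<forall>y\<in>verts G. (x, y) \<in> edges G \<longleftrightarrow> (h x, h y) \<in> edges H)"

definition isomorphic :: "'a graph \<Rightarrow> 'b graph \<Rightarrow> bool"  (infix "\<cong>\<^sub>g" 50) where
  "G \<cong>\<^sub>g H \<longleftrightarrow> (\<exists>h. graph_iso h G H)"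

text \<open>The age of a graph is the class of finite graphs isomorphic to one of its induced
  subgraphs. Every finite graph is isomorphic to one whose vertices are natural numbers, so
  such graphs represent all members of this class.\<close>

definition age :: "'a graph \<Rightarrow> nat graph set" where
  "age G = {F. finite_graph F \<and> (\<exists>A\<subseteq>verts G. F \<cong>\<^sub>g induced_subgraph G A)}"

definition homogeneous :: "'a graph \<Rightarrow> bool" where
  "homogeneous G \<longleftrightarrow>
     (\<forall>A B h. A \<subseteq> verts G \<and> finite A \<and> B \<subseteq> verts G \<and>
        graph_iso h (induced_subgraph G A) (induced_subgraph G B) \<longrightarrow>
        (\<exists>g. graph_iso g G G \<and> (\<forall>x\<in>A. g x = h x)))"

text \<open>The Fraisse limit of a class of finite graphs is the countable homogeneous graph,
  unique up to isomorphism, having that class as its age.\<close>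

definition fraisse_limit :: "nat graph set \<Rightarrow> 'a graph \<Rightarrow> bool" where
  "fraisse_limit K G \<longleftrightarrow> countable_graph G \<and> homogeneous G \<and> age G = K"

definition countable_universal_graph :: "'a graph \<Rightarrow> bool" where
  "countable_universal_graph G \<longleftrightarrow> fraisse_limit {F. finite_graph F} G"

text \<open>Endomorphisms are extensional functions, undefined outside the vertex set, so that
  each endomorphism is represented, and hence counted, exactly once.\<close>

definition endomorphisms :: "'a graph \<Rightarrow> ('a \<Rightarrow> 'a) set" where
  "endomorphisms G =
     {f \<in> verts G \<rightarrow>\<^sub>E verts G. \<forall>(x, y)\<in>edges G. (f x, f y) \<in> edges G}"

definition idempotent_endomorphisms :: "'a graph \<Rightarrow> ('a \<Rightarrow> 'a) set" where
  "idempotent_endomorphisms G = {f \<in> endomorphisms G. compose (verts G) f f = f}"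

definition image_graph :: "('a \<Rightarrow> 'a) \<Rightarrow> 'a graph \<Rightarrow> 'a graph" where
  "image_graph f G = (f ` verts G, map_prod f f ` edges G)"

end

theory Submission
  imports Defs
begin

text \<open>
  An idempotent endomorphism of \<open>R\<close> with image \<open>\<Gamma>\<close> amounts to a pair of homomorphisms
  \<open>\<phi> : R \<rightarrow> \<Gamma>\<close> and \<open>e : \<Gamma> \<rightarrow> R\<close> with \<open>\<phi> \<circ> e = id\<close>. Such a pair is built back and forth from
  finite partial homomorphisms: algebraic closure of \<open>\<Gamma>\<close> allows any further vertex of \<open>R\<close> to be
  added to the domain of \<open>\<phi>\<close>, and the extension property of \<open>R\<close> provides a new preimage
  of a given \<open>c\<close> that is adjacent to every earlier vertex whose value is adjacent to \<open>c\<close>.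

  For the cardinality, replace every vertex of \<open>\<Gamma>\<close> by two nonadjacent twins. The resulting graph
  is again algebraically closed, hence a retract of \<open>R\<close>, and selecting one twin of each vertex of
  the infinite graph \<open>\<Gamma>\<close> yields a continuum of sections of one homomorphism \<open>R \<rightarrow> \<Gamma>\<close>.
\<close>

section \<open>Homomorphisms and embeddings\<close>

lemma is_graph_edgeD:
  assumes "is_graph G" "(x, y) \<in> edges G"
  shows "x \<in> verts G" "y \<in> verts G" "x \<noteq> y" "(y, x) \<in> edges G"
  using assms by (auto simp: is_graph_def irrefl_def sym_def)

definition graph_hom :: "('a \<Rightarrow> 'b) \<Rightarrow> 'a graph \<Rightarrow> 'b graph \<Rightarrow> bool" where
  "graph_hom f G H \<longleftrightarrow> f \<in> verts G \<rightarrow> verts H \<and>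
     (\<forall>x\<in>verts G. \<forall>y\<in>verts G. (x, y) \<in> edges G \<longrightarrow> (f x, f y) \<in> edges H)"

definition graph_embedding :: "('a \<Rightarrow> 'b) \<Rightarrow> 'a graph \<Rightarrow> 'b graph \<Rightarrow> bool" where
  "graph_embedding h G H \<longleftrightarrow> h \<in> verts G \<rightarrow> verts H \<and> inj_on h (verts G) \<and>
     (\<forall>x\<in>verts G. \<forall>y\<in>verts G. (x, y) \<in> edges G \<longleftrightarrow> (h x, h y) \<in> edges H)"

lemma graph_homD:
  assumes "graph_hom f G H"
  shows "x \<in> verts G \<Longrightarrow> f x \<in> verts H"
    and "x \<in> verts G \<Longrightarrow> y \<in> verts G \<Longrightarrow> (x, y) \<in> edges G \<Longrightarrow> (f x, f y) \<in> edges H"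
  using assms by (auto simp: graph_hom_def)

lemma graph_hom_comp:
  assumes "graph_hom f G H" "graph_hom g H K"
  shows "graph_hom (g \<circ> f) G K"
  using assms by (auto simp: graph_hom_def Pi_iff)

lemma graph_iso_imp_hom: "graph_iso h G H \<Longrightarrow> graph_hom h G H"
  by (auto simp: graph_iso_def graph_hom_def bij_betw_def)

lemma graph_embedding_comp:
  assumes "graph_embedding f G H" "graph_embedding g H K"
  shows "graph_embedding (g \<circ> f) G K"
proof -
  have "f ` verts G \<subseteq> verts H"
    using assms(1) by (auto simp: graph_embedding_def)
  then have "inj_on (g \<circ> f) (verts G)"
    using assms by (auto simp: graph_embedding_def intro: comp_inj_on inj_on_subset)
  then show ?thesis
    using assms by (auto simp: graph_embedding_def Pi_iff)
qed

lemma graph_iso_imp_embedding: "graph_iso h G H \<Longrightarrow> graph_embedding h G H"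
  by (auto simp: graph_iso_def graph_embedding_def bij_betw_def)

lemma graph_embedding_induced_subgraph:
  "A \<subseteq> verts G \<Longrightarrow> graph_embedding id (induced_subgraph G A) G"
  by (auto simp: graph_embedding_def induced_subgraph_def)

lemma graph_embedding_imp_iso_image:
  "graph_embedding h G H \<Longrightarrow> graph_iso h G (induced_subgraph H (h ` verts G))"
  by (auto simp: graph_embedding_def graph_iso_def induced_subgraph_def bij_betw_def)

lemma is_graph_induced_subgraph: "is_graph G \<Longrightarrow> is_graph (induced_subgraph G A)"
  by (auto simp: is_graph_def induced_subgraph_def irrefl_def sym_def)


section \<open>The extension property of the universal graph\<close>

definition extension_property :: "'a graph \<Rightarrow> bool" where
  "extension_property G \<longleftrightarrow>
     (\<forall>A U. finite A \<and> A \<subseteq> verts G \<and> U \<subseteq> A \<longrightarrow>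
       (\<exists>z\<in>verts G - A. \<forall>a\<in>A. (z, a) \<in> edges G \<longleftrightarrow> a \<in> U))"

definition relabel_graph :: "('a \<Rightarrow> 'b) \<Rightarrow> 'a graph \<Rightarrow> 'b graph" where
  "relabel_graph k G = (k ` verts G, map_prod k k ` edges G)"

lemma is_graph_relabel_graph:
  assumes "is_graph G" "inj_on k (verts G)"
  shows "is_graph (relabel_graph k G)"
  using is_graph_edgeD[OF assms(1)] inj_onD[OF assms(2)]
  by (fastforce simp: is_graph_def relabel_graph_def irrefl_def sym_def)

lemma graph_iso_relabel_graph:
  assumes "is_graph G" "inj_on k (verts G)"
  shows "graph_iso k G (relabel_graph k G)"
  using is_graph_edgeD(1,2)[OF assms(1)] assms(2)
  by (force simp: graph_iso_def relabel_graph_def inj_on_imp_bij_betw inj_on_eq_iff)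

lemma finite_graph_embeds:
  fixes F :: "'b graph"
  assumes "{F. finite_graph F} \<subseteq> age G" "finite_graph F"
  obtains h where "graph_embedding h F G"
proof -
  have F: "is_graph F" "finite (verts F)"
    using assms(2) by (auto simp: finite_graph_def)
  obtain k :: "'b \<Rightarrow> nat" where k: "inj_on k (verts F)"
    using finite_imp_inj_to_nat_seg[OF F(2)] by blast
  have "finite_graph (relabel_graph k F)"
    using is_graph_relabel_graph[OF F(1) k] F(2) by (simp add: finite_graph_def relabel_graph_def)
  then obtain A h where "A \<subseteq> verts G" "graph_iso h (relabel_graph k F) (induced_subgraph G A)"
    using assms(1) by (auto simp: age_def isomorphic_def)
  then have "graph_embedding (id \<circ> (h \<circ> k)) F G"
    using graph_iso_relabel_graph[OF F(1) k]
    by (blast intro: graph_embedding_comp graph_embedding_induced_subgraph graph_iso_imp_embedding)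
  then show ?thesis
    by (rule that)
qed

lemma homogeneous_extends_embedding:
  assumes "homogeneous G" "finite A" "A \<subseteq> verts G"
    and "graph_embedding h (induced_subgraph G A) G"
  obtains g where "graph_iso g G G" "\<And>a. a \<in> A \<Longrightarrow> g a = h a"
proof -
  have "graph_iso h (induced_subgraph G A) (induced_subgraph G (h ` A))"
    using graph_embedding_imp_iso_image[OF assms(4)] by (simp add: induced_subgraph_def)
  moreover have "h ` A \<subseteq> verts G"
    using assms(4) by (auto simp: graph_embedding_def induced_subgraph_def)
  ultimately show ?thesis
    using assms(1-3) that unfolding homogeneous_def by metis
qed

definition one_point_extension :: "'a graph \<Rightarrow> 'a set \<Rightarrow> 'a option graph" where
  "one_point_extension G U = (insert None (Some ` verts G),
     map_prod Some Some ` edges G \<union> {None} \<times> Some ` U \<union> Some ` U \<times> {None})"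

lemma is_graph_one_point_extension:
  assumes "is_graph G" "U \<subseteq> verts G"
  shows "is_graph (one_point_extension G U)"
  using assms by (auto simp: is_graph_def one_point_extension_def irrefl_def sym_def)

lemma graph_embedding_one_point_extension:
  "graph_embedding Some G (one_point_extension G U)"
  by (auto simp: graph_embedding_def one_point_extension_def)

lemma graph_embedding_one_point_extensionD:
  assumes "graph_embedding h (one_point_extension G U) H"
  shows "h None \<in> verts H"
    and "a \<in> verts G \<Longrightarrow> h None \<noteq> h (Some a)"
    and "a \<in> verts G \<Longrightarrow> (h None, h (Some a)) \<in> edges H \<longleftrightarrow> a \<in> U"
  using assms by (auto simp: graph_embedding_def one_point_extension_def inj_on_def)

lemma homogeneous_extension_property:
  assumes "is_graph G" "homogeneous G" "{F. finite_graph F} \<subseteq> age G"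
  shows "extension_property G"
  unfolding extension_property_def
proof (intro allI impI, elim conjE)
  fix A U assume A: "finite A" "A \<subseteq> verts G" and U: "U \<subseteq> A"
  let ?F = "one_point_extension (induced_subgraph G A) U"
  have "is_graph ?F"
    using U is_graph_induced_subgraph[OF assms(1)]
    by (intro is_graph_one_point_extension) (simp_all add: induced_subgraph_def)
  then have "finite_graph ?F"
    using A(1) by (simp add: finite_graph_def one_point_extension_def induced_subgraph_def)
  then obtain h where h: "graph_embedding h ?F G"
    using finite_graph_embeds[OF assms(3)] by blast
  obtain g where g: "graph_iso g G G" "\<And>a. a \<in> A \<Longrightarrow> g a = (h \<circ> Some) a"
    using homogeneous_extends_embedding[OF assms(2) A
        graph_embedding_comp[OF graph_embedding_one_point_extension h]]
    by blast
  have new: "h None \<in> verts G" "\<And>a. a \<in> A \<Longrightarrow> h None \<noteq> h (Some a)"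
      "\<And>a. a \<in> A \<Longrightarrow> (h None, h (Some a)) \<in> edges G \<longleftrightarrow> a \<in> U"
    using graph_embedding_one_point_extensionD[OF h] by (simp_all add: induced_subgraph_def)
  have "g ` verts G = verts G"
    using g(1) by (simp add: graph_iso_def bij_betw_def)
  then obtain z where z: "z \<in> verts G" "g z = h None"
    using new(1) by (metis imageE)
  have "z \<notin> A"
    using g(2) z(2) new(2) by force
  moreover have "(z, a) \<in> edges G \<longleftrightarrow> a \<in> U" if a: "a \<in> A" for a
  proof -
    have "(z, a) \<in> edges G \<longleftrightarrow> (h None, h (Some a)) \<in> edges G"
      using g z a A(2) by (auto simp: graph_iso_def)
    also have "\<dots> \<longleftrightarrow> a \<in> U"
      using new(3) a .
    finally show ?thesis .
  qed
  ultimately show "\<exists>z\<in>verts G - A. \<forall>a\<in>A. (z, a) \<in> edges G \<longleftrightarrow> a \<in> U"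
    using z(1) by blast
qed


section \<open>Algebraically closed graphs\<close>

lemma extension_property_imp_algebraically_closed:
  "extension_property G \<Longrightarrow> algebraically_closed G"
  unfolding extension_property_def algebraically_closed_def by (metis DiffD1 order_refl)

lemma algebraically_closed_surj_hom:
  assumes "algebraically_closed G" "graph_hom f G H" "f ` verts G = verts H"
  shows "algebraically_closed H"
  unfolding algebraically_closed_def
proof (intro allI impI, elim conjE)
  fix A assume "finite A" "A \<subseteq> verts H"
  then obtain B where B: "B \<subseteq> verts G" "finite B" "A = f ` B"
    using assms(3) finite_subset_image by metis
  then obtain v where "v \<in> verts G" "\<forall>b\<in>B. (v, b) \<in> edges G"
    using assms(1) by (auto simp: algebraically_closed_def)
  then show "\<exists>v\<in>verts H. \<forall>a\<in>A. (v, a) \<in> edges H"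
    using B graph_homD[OF assms(2)] by (intro bexI[of _ "f v"]) auto
qed

lemma algebraically_closed_image_graph:
  "algebraically_closed G \<Longrightarrow> algebraically_closed (image_graph f G)"
  by (rule algebraically_closed_surj_hom[of _ f]) (auto simp: graph_hom_def image_graph_def)

lemma algebraically_closed_isomorphic:
  assumes "algebraically_closed G" "G \<cong>\<^sub>g H"
  shows "algebraically_closed H"
  using assms algebraically_closed_surj_hom graph_iso_imp_hom
  unfolding isomorphic_def graph_iso_def bij_betw_def by metis

lemma algebraically_closed_infinite:
  assumes "is_graph G" "algebraically_closed G"
  shows "infinite (verts G)"
proof
  assume "finite (verts G)"
  then obtain v where "v \<in> verts G" "\<forall>a\<in>verts G. (v, a) \<in> edges G"
    using assms(2) unfolding algebraically_closed_def by blast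
  then show False
    using is_graph_edgeD(3)[OF assms(1)] by blast
qed


section \<open>Partial homomorphisms\<close>

definition partial_hom :: "'a graph \<Rightarrow> 'b graph \<Rightarrow> ('a \<times> 'b) set \<Rightarrow> bool" where
  "partial_hom G H P \<longleftrightarrow> P \<subseteq> verts G \<times> verts H \<and> single_valued P \<and>
     (\<forall>(x, a)\<in>P. \<forall>(y, b)\<in>P. (x, y) \<in> edges G \<longrightarrow> (a, b) \<in> edges H)"

lemma partial_homD:
  assumes "partial_hom G H P"
  shows "(x, a) \<in> P \<Longrightarrow> x \<in> verts G" "(x, a) \<in> P \<Longrightarrow> a \<in> verts H"
    and "(x, a) \<in> P \<Longrightarrow> (x, b) \<in> P \<Longrightarrow> a = b"
    and "(x, a) \<in> P \<Longrightarrow> (y, b) \<in> P \<Longrightarrow> (x, y) \<in> edges G \<Longrightarrow> (a, b) \<in> edges H"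
  using assms by (auto simp: partial_hom_def single_valued_def)

lemma partial_hom_empty: "partial_hom G H {}"
  by (simp add: partial_hom_def)

lemma partial_hom_insert:
  assumes "is_graph G" "is_graph H" "partial_hom G H P"
    and "x \<in> verts G" "a \<in> verts H" "x \<notin> Domain P"
    and adj: "\<And>y b. (y, b) \<in> P \<Longrightarrow> (x, y) \<in> edges G \<Longrightarrow> (a, b) \<in> edges H"
  shows "partial_hom G H (insert (x, a) P)"
proof -
  have "(b, c) \<in> edges H"
    if "(y, b) \<in> insert (x, a) P" "(z, c) \<in> insert (x, a) P" "(y, z) \<in> edges G" for y z b c
    using that partial_homD(4)[OF assms(3)] adj
      is_graph_edgeD(3,4)[OF assms(1) that(3)] is_graph_edgeD(4)[OF assms(2)] by auto
  moreover have "single_valued (insert (x, a) P)"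
    using assms(3,6) by (auto simp: partial_hom_def single_valued_def)
  ultimately show ?thesis
    using assms(3-5) unfolding partial_hom_def by fast
qed

lemma partial_hom_UN_mono:
  fixes P :: "nat \<Rightarrow> ('a \<times> 'b) set"
  assumes "mono P" "\<And>n. partial_hom G H (P n)"
  shows "partial_hom G H (\<Union>n. P n)"
proof -
  have common: "\<exists>n. p \<in> P n \<and> q \<in> P n" if "p \<in> (\<Union>n. P n)" "q \<in> (\<Union>n. P n)" for p q
    using that assms(1) unfolding mono_def by (metis UN_iff in_mono nat_le_linear)
  have "single_valued (\<Union>n. P n)"
    using common partial_homD(3)[OF assms(2)] by (metis single_valuedI)
  moreover have "(a, b) \<in> edges H"
    if "(x, a) \<in> (\<Union>n. P n)" "(y, b) \<in> (\<Union>n. P n)" "(x, y) \<in> edges G" for x y a b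
    using common[OF that(1,2)] partial_homD(4)[OF assms(2)] that(3) by blast
  moreover have "(\<Union>n. P n) \<subseteq> verts G \<times> verts H"
    using partial_homD(1,2)[OF assms(2)] by auto
  ultimately show ?thesis
    unfolding partial_hom_def by blast
qed

lemma total_partial_hom_imp_graph_hom:
  assumes "partial_hom G H P" "verts G \<subseteq> Domain P"
  obtains f where "graph_hom f G H" "\<And>x. x \<in> verts G \<Longrightarrow> (x, f x) \<in> P"
proof -
  have "\<forall>x\<in>verts G. \<exists>a. (x, a) \<in> P"
    using assms(2) by blast
  then obtain f where f: "\<And>x. x \<in> verts G \<Longrightarrow> (x, f x) \<in> P"
    using bchoice[of "verts G" "\<lambda>x a. (x, a) \<in> P"] by blast
  then have "graph_hom f G H"
    using partial_homD[OF assms(1)] unfolding graph_hom_def by blast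
  with f show ?thesis
    using that by blast
qed


section \<open>Retractions onto algebraically closed graphs\<close>

definition graph_retraction ::
    "('a \<Rightarrow> 'b) \<Rightarrow> ('b \<Rightarrow> 'a) \<Rightarrow> 'a graph \<Rightarrow> 'b graph \<Rightarrow> bool" where
  "graph_retraction \<phi> e G H \<longleftrightarrow>
     graph_hom \<phi> G H \<and> graph_hom e H G \<and> (\<forall>c\<in>verts H. \<phi> (e c) = c)"

definition finite_partial_retraction ::
    "'a graph \<Rightarrow> 'b graph \<Rightarrow> ('a \<times> 'b) set \<Rightarrow> ('b \<times> 'a) set \<Rightarrow> bool" where
  "finite_partial_retraction G H P S \<longleftrightarrow>
     finite P \<and> partial_hom G H P \<and> partial_hom H G S \<and> S\<inverse> \<subseteq> P"

lemma finite_partial_retraction_extend_retraction: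
  assumes "is_graph G" "is_graph H" "algebraically_closed H"
    and PS: "finite_partial_retraction G H P S" and "x \<in> verts G"
  obtains Q where "finite_partial_retraction G H Q S" "P \<subseteq> Q" "x \<in> Domain Q"
proof (cases "x \<in> Domain P")
  case True
  then show ?thesis using that PS by blast
next
  case False
  have P: "finite P" "partial_hom G H P"
    using PS by (auto simp: finite_partial_retraction_def)
  then have "finite (Range P)" "Range P \<subseteq> verts H"
    by (auto simp: finite_Range dest: partial_homD(2))
  then obtain c where "c \<in> verts H" "\<forall>a\<in>Range P. (c, a) \<in> edges H"
    using assms(3) by (auto simp: algebraically_closed_def)
  then have "partial_hom G H (insert (x, c) P)"
    using assms(1,2,5) P False by (intro partial_hom_insert) auto
  then have "finite_partial_retraction G H (insert (x, c) P) S"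
    using PS by (auto simp: finite_partial_retraction_def)
  then show ?thesis
    using that by blast
qed

lemma finite_partial_retraction_extend_section:
  assumes "is_graph G" "is_graph H" "extension_property G"
    and PS: "finite_partial_retraction G H P S" and "c \<in> verts H"
  obtains Q T where "finite_partial_retraction G H Q T" "P \<subseteq> Q" "S \<subseteq> T" "c \<in> Domain T"
proof (cases "c \<in> Domain S")
  case True
  then show ?thesis using that PS by blast
next
  case False
  have P: "finite P" "partial_hom G H P" and S: "partial_hom H G S" "S\<inverse> \<subseteq> P"
    using PS by (auto simp: finite_partial_retraction_def)
  define U where "U = {y. \<exists>b. (y, b) \<in> P \<and> (c, b) \<in> edges H}"
  have "finite (Domain P)" "Domain P \<subseteq> verts G" "U \<subseteq> Domain P"
    using P by (auto simp: finite_Domain U_def dest: partial_homD(1))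
  then obtain x where x: "x \<in> verts G" "x \<notin> Domain P"
      "\<And>y. y \<in> Domain P \<Longrightarrow> (x, y) \<in> edges G \<longleftrightarrow> y \<in> U"
    using assms(3) unfolding extension_property_def by (metis DiffE)
  have adj: "(x, y) \<in> edges G \<longleftrightarrow> (c, b) \<in> edges H" if "(y, b) \<in> P" for y b
    using x(3)[of y] that partial_homD(3)[OF P(2)] unfolding U_def by blast
  have "partial_hom G H (insert (x, c) P)"
    using assms(1,2,5) P(2) x(1,2) adj by (intro partial_hom_insert) auto
  moreover have "partial_hom H G (insert (c, x) S)"
    using assms(1,2,5) S x(1) False adj by (intro partial_hom_insert) auto
  ultimately have "finite_partial_retraction G H (insert (x, c) P) (insert (c, x) S)"
    using P(1) S(2) by (auto simp: finite_partial_retraction_def)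
  then show ?thesis
    using that by blast
qed

lemma finite_partial_retraction_chain:
  fixes G :: "'a graph" and H :: "'b graph"
  assumes G: "is_graph G" "extension_property G" and H: "is_graph H" "algebraically_closed H"
    and x: "\<And>n. x n \<in> verts G" and c: "\<And>n. c n \<in> verts H"
  obtains P S where "mono P" "mono S" "\<And>n. finite_partial_retraction G H (P n) (S n)"
    "\<And>n. x n \<in> Domain (P (Suc n))" "\<And>n. c n \<in> Domain (S (Suc n))"
proof -
  define valid where "valid p \<longleftrightarrow> finite_partial_retraction G H (fst p) (snd p)" for p
  define step where "step n p q \<longleftrightarrow> fst p \<subseteq> fst q \<and> snd p \<subseteq> snd q \<and>
      x n \<in> Domain (fst q) \<and> c n \<in> Domain (snd q)"
    for n and p q :: "('a \<times> 'b) set \<times> ('b \<times> 'a) set"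
  have "\<exists>F. \<forall>n. valid (F n) \<and> step n (F n) (F (Suc n))"
  proof (rule dependent_nat_choice)
    have "valid ({}, {})"
      by (simp add: valid_def finite_partial_retraction_def partial_hom_empty)
    then show "\<exists>p. valid p" ..
  next
    fix p n assume p: "valid p"
    obtain Q where Q: "finite_partial_retraction G H Q (snd p)" "fst p \<subseteq> Q" "x n \<in> Domain Q"
      using finite_partial_retraction_extend_retraction[OF G(1) H p[unfolded valid_def] x] .
    obtain Q' T where "finite_partial_retraction G H Q' T" "Q \<subseteq> Q'" "snd p \<subseteq> T" "c n \<in> Domain T"
      using finite_partial_retraction_extend_section[OF G(1) H(1) G(2) Q(1) c] .
    then have "valid (Q', T) \<and> step n p (Q', T)"
      using Q by (auto simp: valid_def step_def)
    then show "\<exists>q. valid q \<and> step n p q" ..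
  qed
  then obtain F where F: "\<And>n. valid (F n)" "\<And>n. step n (F n) (F (Suc n))"
    by blast
  show ?thesis
  proof
    show "mono (\<lambda>n. fst (F n))" "mono (\<lambda>n. snd (F n))"
      using F(2) by (simp_all add: step_def mono_iff_le_Suc)
    show "finite_partial_retraction G H (fst (F n)) (snd (F n))" for n
      using F(1) by (simp add: valid_def)
    show "x n \<in> Domain (fst (F (Suc n)))" "c n \<in> Domain (snd (F (Suc n)))" for n
      using F(2) by (simp_all add: step_def)
  qed
qed

lemma extension_property_ex_graph_retraction:
  fixes G :: "'a graph" and H :: "'b graph"
  assumes G: "countable_graph G" "extension_property G"
    and H: "countable_graph H" "algebraically_closed H"
  shows "\<exists>\<phi> e. graph_retraction \<phi> e G H"
proof -
  have gr: "is_graph G" "is_graph H" and cnt: "countable (verts G)" "countable (verts H)"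
    using assms by (auto simp: countable_graph_def)
  have "verts G \<noteq> {}" "verts H \<noteq> {}"
    using algebraically_closed_infinite[OF gr(1)] algebraically_closed_infinite[OF gr(2) H(2)]
      extension_property_imp_algebraically_closed[OF G(2)] by auto
  then obtain x :: "nat \<Rightarrow> 'a" and c :: "nat \<Rightarrow> 'b"
    where enum: "range x = verts G" "range c = verts H"
    using range_from_nat_into[OF _ cnt(1)] range_from_nat_into[OF _ cnt(2)] by meson
  obtain P S where mono: "mono P" "mono S"
      and PS: "\<And>n. finite_partial_retraction G H (P n) (S n)"
      and dom: "\<And>n. x n \<in> Domain (P (Suc n))" "\<And>n. c n \<in> Domain (S (Suc n))"
    using finite_partial_retraction_chain[OF gr(1) G(2) gr(2) H(2), of x c] enum by blast
  have hom: "partial_hom G H (\<Union>n. P n)" "partial_hom H G (\<Union>n. S n)"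
    using partial_hom_UN_mono mono PS unfolding finite_partial_retraction_def by blast+
  have "verts G \<subseteq> Domain (\<Union>n. P n)"
    using dom(1) unfolding enum(1)[symmetric] by blast
  then obtain \<phi> where \<phi>: "graph_hom \<phi> G H" "\<And>x. x \<in> verts G \<Longrightarrow> (x, \<phi> x) \<in> (\<Union>n. P n)"
    using total_partial_hom_imp_graph_hom[OF hom(1)] by blast
  have "verts H \<subseteq> Domain (\<Union>n. S n)"
    using dom(2) unfolding enum(2)[symmetric] by blast
  then obtain e where e: "graph_hom e H G" "\<And>c. c \<in> verts H \<Longrightarrow> (c, e c) \<in> (\<Union>n. S n)"
    using total_partial_hom_imp_graph_hom[OF hom(2)] by blast
  have "\<phi> (e c) = c" if "c \<in> verts H" for c
  proof -
    have "(e c, c) \<in> (\<Union>n. P n)"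
      using e(2)[OF that] PS unfolding finite_partial_retraction_def by blast
    then show ?thesis
      using partial_homD(3)[OF hom(1)] \<phi>(2) graph_homD(1)[OF e(1) that] by blast
  qed
  then show ?thesis
    using \<phi>(1) e(1) by (auto simp: graph_retraction_def)
qed


section \<open>Idempotent endomorphisms\<close>

abbreviation (input) idempotents_onto :: "'a graph \<Rightarrow> 'b graph \<Rightarrow> ('a \<Rightarrow> 'a) set" where
  "idempotents_onto G H \<equiv> {f \<in> idempotent_endomorphisms G. image_graph f G \<cong>\<^sub>g H}"

lemma graph_retractionD:
  assumes "graph_retraction \<phi> e G H"
  shows "graph_hom \<phi> G H" "graph_hom e H G" "c \<in> verts H \<Longrightarrow> \<phi> (e c) = c"
  using assms by (auto simp: graph_retraction_def)

lemma graph_retraction_comp: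
  assumes "graph_retraction \<phi> e G H" "graph_retraction \<psi> d H K"
  shows "graph_retraction (\<psi> \<circ> \<phi>) (e \<circ> d) G K"
  using assms graph_homD(1)[of d K H] unfolding graph_retraction_def
  by (auto intro: graph_hom_comp)

lemma graph_retraction_idempotent_endomorphism:
  assumes "is_graph G" "graph_retraction \<phi> e G H"
  shows "compose (verts G) e \<phi> \<in> idempotent_endomorphisms G"
proof -
  let ?f = "compose (verts G) e \<phi>"
  note hom = graph_homD[OF graph_retractionD(1)[OF assms(2)]]
    graph_homD[OF graph_retractionD(2)[OF assms(2)]]
  have "?f \<in> verts G \<rightarrow>\<^sub>E verts G"
    using hom by (auto simp: compose_def)
  moreover have "(?f x, ?f y) \<in> edges G" if "(x, y) \<in> edges G" for x y
    using hom that is_graph_edgeD(1,2)[OF assms(1) that] by (simp add: compose_def)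
  moreover have "compose (verts G) ?f ?f = ?f"
    using hom graph_retractionD(3)[OF assms(2)] by (auto simp: compose_def fun_eq_iff)
  ultimately show ?thesis
    by (auto simp: idempotent_endomorphisms_def endomorphisms_def)
qed

lemma graph_retraction_image_iso:
  assumes "is_graph G" "graph_retraction \<phi> e G H"
  shows "graph_iso \<phi> (image_graph (compose (verts G) e \<phi>) G) H"
proof -
  let ?f = "compose (verts G) e \<phi>"
  note \<phi> = graph_homD[OF graph_retractionD(1)[OF assms(2)]]
  note e = graph_homD[OF graph_retractionD(2)[OF assms(2)]]
  note sec = graph_retractionD(3)[OF assms(2)]
  have f: "?f x = e (\<phi> x)" "\<phi> (?f x) = \<phi> x" if "x \<in> verts G" for x
    using that \<phi> sec by (auto simp: compose_def)
  have image: "?f ` verts G = e ` verts H"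
  proof
    show "e ` verts H \<subseteq> ?f ` verts G"
      using e(1) f(1) sec by (metis image_eqI image_subsetI)
  qed (use f(1) \<phi>(1) in auto)
  have "bij_betw \<phi> (?f ` verts G) (verts H)"
    unfolding image using sec by (intro bij_betw_byWitness[where f' = e]) auto
  moreover have "(x, y) \<in> map_prod ?f ?f ` edges G \<longleftrightarrow> (\<phi> x, \<phi> y) \<in> edges H"
    if "x \<in> ?f ` verts G" "y \<in> ?f ` verts G" for x y
  proof
    assume "(x, y) \<in> map_prod ?f ?f ` edges G"
    then show "(\<phi> x, \<phi> y) \<in> edges H"
      using f(2) \<phi>(2) is_graph_edgeD(1,2)[OF assms(1)] by auto
  next
    assume "(\<phi> x, \<phi> y) \<in> edges H"
    moreover have xy: "x \<in> verts G" "y \<in> verts G" "e (\<phi> x) = x" "e (\<phi> y) = y"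
      using that e(1) sec unfolding image by auto
    ultimately have "(x, y) \<in> edges G"
      using e(2) \<phi>(1) by metis
    then show "(x, y) \<in> map_prod ?f ?f ` edges G"
      using xy f(1) by (intro image_eqI[of _ _ "(x, y)"]) auto
  qed
  ultimately show ?thesis
    by (simp add: graph_iso_def image_graph_def)
qed

lemma graph_retraction_idempotents_onto:
  assumes "is_graph G" "graph_retraction \<phi> e G H"
  shows "compose (verts G) e \<phi> \<in> idempotents_onto G H"
  using graph_retraction_idempotent_endomorphism[OF assms] graph_retraction_image_iso[OF assms]
  by (auto simp: isomorphic_def)

lemma compose_section_inject:
  assumes "graph_retraction \<phi> e G H" "graph_retraction \<phi> d G H"
    and "compose (verts G) e \<phi> = compose (verts G) d \<phi>" "c \<in> verts H"
  shows "e c = d c"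
proof -
  have "e c \<in> verts G" "\<phi> (e c) = c"
    using assms(1,4) by (auto simp: graph_retraction_def dest: graph_homD(1))
  then show ?thesis
    using fun_cong[OF assms(3), of "e c"] by (simp add: compose_def)
qed


section \<open>Counting idempotent endomorphisms\<close>

definition twin_graph :: "'a graph \<Rightarrow> ('a \<times> bool) graph" where
  "twin_graph G = (verts G \<times> UNIV, {(p, q). (fst p, fst q) \<in> edges G})"

lemma countable_graph_twin_graph: "countable_graph G \<Longrightarrow> countable_graph (twin_graph G)"
  by (auto simp: countable_graph_def is_graph_def twin_graph_def irrefl_def sym_def)

lemma graph_retraction_twin_graph: "graph_retraction fst (\<lambda>c. (c, c \<in> S)) (twin_graph G) G"
  by (auto simp: graph_retraction_def graph_hom_def twin_graph_def)

lemma algebraically_closed_twin_graph: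
  assumes "algebraically_closed G"
  shows "algebraically_closed (twin_graph G)"
  unfolding algebraically_closed_def
proof (intro allI impI, elim conjE)
  fix A assume "finite A" "A \<subseteq> verts (twin_graph G)"
  then have "finite (fst ` A)" "fst ` A \<subseteq> verts G"
    by (auto simp: twin_graph_def)
  then obtain v where "v \<in> verts G" "\<forall>a\<in>fst ` A. (v, a) \<in> edges G"
    using assms by (auto simp: algebraically_closed_def)
  then show "\<exists>v\<in>verts (twin_graph G). \<forall>a\<in>A. (v, a) \<in> edges (twin_graph G)"
    by (intro bexI[of _ "(v, True)"]) (auto simp: twin_graph_def)
qed

lemma Pow_verts_lepoll_idempotents_onto:
  assumes "is_graph G" "graph_retraction \<phi> e G (twin_graph H)"
  shows "Pow (verts H) \<lesssim> idempotents_onto G H"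
proof -
  define sec where "sec S = e \<circ> (\<lambda>c. (c, c \<in> S))" for S
  define f where "f S = compose (verts G) (sec S) (fst \<circ> \<phi>)" for S
  have retr: "graph_retraction (fst \<circ> \<phi>) (sec S) G H" for S
    unfolding sec_def using graph_retraction_comp[OF assms(2) graph_retraction_twin_graph] .
  have "inj_on f (Pow (verts H))"
  proof (rule inj_onI)
    fix S T assume ST: "S \<in> Pow (verts H)" "T \<in> Pow (verts H)" "f S = f T"
    have "c \<in> S \<longleftrightarrow> c \<in> T" if c: "c \<in> verts H" for c
    proof -
      have "e (c, c \<in> S) = e (c, c \<in> T)"
        using compose_section_inject[OF retr retr ST(3)[unfolded f_def] c] by (simp add: sec_def)
      moreover have "\<phi> (e (c, b)) = (c, b)" for b
        using graph_retractionD(3)[OF assms(2)] c by (simp add: twin_graph_def)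
      ultimately show ?thesis
        by (metis prod.inject)
    qed
    then show "S = T"
      using ST(1,2) by blast
  qed
  moreover have "f ` Pow (verts H) \<subseteq> idempotents_onto G H"
    using graph_retraction_idempotents_onto[OF assms(1) retr] unfolding f_def by blast
  ultimately show ?thesis
    unfolding lepoll_def by blast
qed

lemma Pow_lepoll_mono: "A \<lesssim> B \<Longrightarrow> Pow A \<lesssim> Pow B"
  unfolding lepoll_def by (metis inj_on_image_Pow image_Pow_mono)

lemma PiE_lepoll_Pow_Times: "(A \<rightarrow>\<^sub>E B) \<lesssim> Pow (A \<times> B)"
proof -
  define graph_of where "graph_of f = (\<lambda>x. (x, f x)) ` A" for f :: "'a \<Rightarrow> 'b"
  have "inj_on graph_of (A \<rightarrow>\<^sub>E B)"
  proof (intro inj_onI PiE_ext)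
    fix f g x assume "graph_of f = graph_of g" "x \<in> A"
    then have "(x, f x) \<in> graph_of g"
      by (auto simp: graph_of_def)
    then show "f x = g x"
      by (auto simp: graph_of_def)
  qed
  moreover have "graph_of ` (A \<rightarrow>\<^sub>E B) \<subseteq> Pow (A \<times> B)"
    by (auto simp: graph_of_def)
  ultimately show ?thesis
    unfolding lepoll_def by blast
qed

lemma idempotents_onto_lepoll_continuum:
  assumes "countable (verts G)"
  shows "idempotents_onto G H \<lesssim> (UNIV :: nat set set)"
proof -
  have "idempotents_onto G H \<lesssim> (verts G \<rightarrow>\<^sub>E verts G)"
    by (rule subset_imp_lepoll) (auto simp: idempotent_endomorphisms_def endomorphisms_def)
  also have "\<dots> \<lesssim> Pow (verts G \<times> verts G)"
    by (rule PiE_lepoll_Pow_Times)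
  also have "\<dots> \<lesssim> Pow (UNIV :: nat set)"
    using countable_SIGMA[OF assms assms]
    by (intro Pow_lepoll_mono) (auto simp: countable_def lepoll_def)
  finally show ?thesis
    by simp
qed

lemma continuum_lepoll_idempotents_onto:
  assumes "countable_graph G" "extension_property G"
    and "countable_graph H" "algebraically_closed H"
  shows "(UNIV :: nat set set) \<lesssim> idempotents_onto G H"
proof -
  have gr: "is_graph G" "is_graph H"
    using assms by (auto simp: countable_graph_def)
  obtain \<phi> e where retr: "graph_retraction \<phi> e G (twin_graph H)"
    using extension_property_ex_graph_retraction assms
      countable_graph_twin_graph algebraically_closed_twin_graph by blast
  have "Pow (UNIV :: nat set) \<lesssim> Pow (verts H)"
    using algebraically_closed_infinite[OF gr(2) assms(4)]
    by (intro Pow_lepoll_mono) (simp add: infinite_le_lepoll)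
  also have "\<dots> \<lesssim> idempotents_onto G H"
    by (rule Pow_verts_lepoll_idempotents_onto[OF gr(1) retr])
  finally show ?thesis
    by simp
qed

theorem theorem3p6:
  fixes R :: "'a graph" and \<Gamma> :: "'b graph"
  assumes "countable_universal_graph R"
    and "countable_graph \<Gamma>"
  shows "((\<exists>f\<in>idempotent_endomorphisms R. image_graph f R \<cong>\<^sub>g \<Gamma>) \<longleftrightarrow> algebraically_closed \<Gamma>)
    \<and> (algebraically_closed \<Gamma> \<longrightarrow>
         {f \<in> idempotent_endomorphisms R. image_graph f R \<cong>\<^sub>g \<Gamma>} \<approx> (UNIV :: nat set set))"
proof -
  have R: "countable_graph R" "is_graph R" "countable (verts R)" "extension_property R"
    using assms(1) homogeneous_extension_property[of R]
    by (auto simp: countable_universal_graph_def fraisse_limit_def countable_graph_def)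
  have closed: "algebraically_closed \<Gamma>" if "image_graph f R \<cong>\<^sub>g \<Gamma>" for f
    using extension_property_imp_algebraically_closed[OF R(4)] that
      algebraically_closed_image_graph algebraically_closed_isomorphic by blast
  have "\<exists>f\<in>idempotent_endomorphisms R. image_graph f R \<cong>\<^sub>g \<Gamma>" if "algebraically_closed \<Gamma>"
    using extension_property_ex_graph_retraction[OF R(1,4) assms(2) that]
      graph_retraction_idempotents_onto[OF R(2)] by blast
  moreover have "idempotents_onto R \<Gamma> \<approx> (UNIV :: nat set set)" if "algebraically_closed \<Gamma>"
    using idempotents_onto_lepoll_continuum[OF R(3)]
      continuum_lepoll_idempotents_onto[OF R(1,4) assms(2) that] by (rule lepoll_antisym)
  ultimately show ?thesis
    using closed by blast
qed

end
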